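(* Let $M>1$ be an integer and let $a$ be an odd integer. Then: (a) \[\sum_{n=1}^{\infty}\frac{1}{n}\,\mathrm{Ct}_q\Big(\frac{(2n+a)\pi}{2M}\Big)=-\frac{1}{M}\sum_{k=1}^{M}\mathrm{Ct}_q\Big(\frac{(2k+a)\pi}{2M}\Big)\,\psi\Big(\frac{k}{M}\Big).\] (b) Define, for integers $k$, \[h_{q,M,a}(k)=\frac{1}{\pi}\Big((\log q)\,\frac{2k+a-M}{2M}-\psi_q\Big(\frac{2k+a}{2M}\Big)+\psi_q\Big(1-\frac{2k+a}{2M}\Big)\Big).\] Then $h_{q,M,a}$ is periodic with period $M$, and \[\sum_{n=1}^{\infty}\frac{h_{q,M,a}(n)}{n}=-\frac{1}{M}\sum_{k=1}^{M}h_{q,M,a}(k)\,\psi\Big(\frac{k}{M}\Big).\] (c) Define, for integers $k$, \[f_{q,M,a}(k)=\sum_{n=1}^{\infty}\frac{q^{2n/M}}{1-q^{2n/M}}\sin\frac{(2k+a)n\pi}{M}.\] Then $f_{q,M,a}$ is periodic with period $M$, and \[\sum_{n=1}^{\infty}\frac{f_{q,M,a}(n)}{n}=-\frac{1}{M}\sum_{k=1}^{M}f_{q,M,a}(k)\,\psi\Big(\frac{k}{M}\Big).\]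
   Context: Let $\tau$ be a complex number with $\mathrm{Im}(\tau)>0$ and $q=e^{\pi i\tau}$ (so $|q|<1$). For any base $p=e^{\pi i\sigma}$ with $\mathrm{Im}\,\sigma>0$ (e.g. $p=q^r=e^{\pi i r\tau}$ for real $r>0$), write $p^s:=e^{\pi i\sigma s}$ for complex $s$ and $\log p:=\pi i\sigma$. $q$-shifted factorials: $(x;p)_\infty=\prod_{i\ge0}(1-xp^i)$. The $q$-gamma function is $\Gamma_p(z)=\frac{(p;p)_\infty}{(p^z;p)_\infty}(1-p)^{1-z}$ (principal branch), and the $q$-digamma function is $\psi_p(z)=\Gamma_p'(z)/\Gamma_p(z)$; $\psi(z)=\Gamma'(z)/\Gamma(z)$ is the classical digamma function. Gosper's $q$-sine is defined by \[\sin_p(\pi z)=p^{1/4}\,\Gamma_{p^2}\big(\tfrac12\big)^2\,\frac{p^{z(z-1)}}{\Gamma_{p^2}(z)\,\Gamma_{p^2}(1-z)},\] and $\mathrm{Ct}_p(w)=\sin_p'(w)/\sin_p(w)$, where $'$ denotes the derivative with respect to $w$. *)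

theory Defs
  imports "HOL-Analysis.Analysis"
begin

text \<open>
  A base \<open>p = exp (\<pi> \<i> \<sigma>)\<close> is represented by \<open>\<sigma>\<close>, since the powers \<open>p\<^sup>s\<close> and the
  logarithm \<open>log p = \<pi> \<i> \<sigma>\<close> depend on \<open>\<sigma>\<close> and not only on \<open>p\<close>. The base \<open>p\<^sup>r\<close> is
  represented by \<open>r \<sigma>\<close>.
\<close>

definition base_log :: "complex \<Rightarrow> complex" where
  "base_log \<sigma> = of_real pi * \<i> * \<sigma>"

definition base_pow :: "complex \<Rightarrow> complex \<Rightarrow> complex" where
  "base_pow \<sigma> s = exp (base_log \<sigma> * s)"

definition qpoch_inf :: "complex \<Rightarrow> complex \<Rightarrow> complex" where
  "qpoch_inf x p = prodinf (\<lambda>i. 1 - x * p ^ i)"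

definition qGamma :: "complex \<Rightarrow> complex \<Rightarrow> complex" where
  "qGamma \<sigma> z =
     (let p = base_pow \<sigma> 1
      in qpoch_inf p p / qpoch_inf (base_pow \<sigma> z) p * (1 - p) powr (1 - z))"

definition qDigamma :: "complex \<Rightarrow> complex \<Rightarrow> complex" where
  "qDigamma \<sigma> z = deriv (qGamma \<sigma>) z / qGamma \<sigma> z"

text \<open>
  Gosper's q-sine as a function of \<open>w = \<pi> z\<close>. Where \<open>qGamma\<close> has a pole its value is \<open>0\<close> by
  the convention on division, so \<open>qSin\<close> is \<open>0\<close> there, as it should be.
\<close>

definition qSin :: "complex \<Rightarrow> complex \<Rightarrow> complex" where
  "qSin \<sigma> w =
     (let z = w / of_real pi
      in base_pow \<sigma> (1/4) * (qGamma (2 * \<sigma>) (1/2))\<^sup>2 *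
         (base_pow \<sigma> (z * (z - 1)) / (qGamma (2 * \<sigma>) z * qGamma (2 * \<sigma>) (1 - z))))"

definition qCt :: "complex \<Rightarrow> complex \<Rightarrow> complex" where
  "qCt \<sigma> w = deriv (qSin \<sigma>) w / qSin \<sigma> w"

definition h_fun :: "complex \<Rightarrow> nat \<Rightarrow> int \<Rightarrow> int \<Rightarrow> complex" where
  "h_fun \<tau> M a k =
     1 / of_real pi *
       (base_log \<tau> * (of_int (2 * k + a - int M) / of_nat (2 * M))
        - qDigamma \<tau> (of_int (2 * k + a) / of_nat (2 * M))
        + qDigamma \<tau> (1 - of_int (2 * k + a) / of_nat (2 * M)))"

definition f_term :: "complex \<Rightarrow> nat \<Rightarrow> int \<Rightarrow> int \<Rightarrow> nat \<Rightarrow> complex" where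
  "f_term \<tau> M a k n =
     base_pow \<tau> (of_nat (2 * n) / of_nat M) / (1 - base_pow \<tau> (of_nat (2 * n) / of_nat M)) *
     of_real (sin (of_int (2 * k + a) * of_nat n * pi / of_nat M))"

definition f_fun :: "complex \<Rightarrow> nat \<Rightarrow> int \<Rightarrow> int \<Rightarrow> complex" where
  "f_fun \<tau> M a k = (\<Sum>n. f_term \<tau> M a k (Suc n))"

lemma summable_f_term:
  assumes "Im \<tau> > 0" "M > 0"
  shows "summable (\<lambda>n. f_term \<tau> M a k (Suc n))"
proof -
  define r where "r = exp (- (2 * pi * Im \<tau> / real M))"
  have r: "0 < r" "r < 1"
    using assms by (simp_all add: r_def)
  have nq: "norm (base_pow \<tau> (of_nat (2 * n) / of_nat M)) = r ^ n" for n
  proof -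
    have "Re (base_log \<tau> * (of_nat (2 * n) / of_nat M)) = real n * - (2 * pi * Im \<tau> / real M)"
      using Re_divide_of_nat[of "base_log \<tau> * of_nat (2 * n)" M] by (simp add: base_log_def)
    thus ?thesis
      by (simp only: base_pow_def norm_exp_eq_Re r_def exp_of_nat_mult)
  qed
  show ?thesis
  proof (rule summable_comparison_test', rule summable_mult)
    show "summable (\<lambda>n. r ^ n)"
      using r by simp
  next
    fix n :: nat
    let ?z = "base_pow \<tau> (of_nat (2 * Suc n) / of_nat M)"
    have z: "norm ?z \<le> r ^ n" "norm ?z \<le> r"
      unfolding nq using r by (simp_all add: mult_left_le_one_le mult_left_le power_le_one)
    have "1 - r \<le> norm (1 - ?z)"
      using z(2) norm_triangle_ineq2[of 1 ?z] by simp
    hence "norm (?z / (1 - ?z)) \<le> r ^ n / (1 - r)"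
      unfolding norm_divide using z r by (intro frac_le) auto
    moreover have "norm (of_real (sin (of_int (2 * k + a) * of_nat (Suc n) * pi / of_nat M)) :: complex) \<le> 1"
      unfolding norm_of_real by (rule abs_sin_le_one)
    ultimately have "norm (f_term \<tau> M a k (Suc n)) \<le> r ^ n / (1 - r) * 1"
      unfolding f_term_def norm_mult using r by (intro mult_mono) auto
    thus "norm (f_term \<tau> M a k (Suc n)) \<le> 1 / (1 - r) * r ^ n"
      by simp
  qed
qed

end

theory Submission
  imports Defs "HOL-Complex_Analysis.Cauchy_Integral_Formula"
begin

text \<open>
  If \<open>f\<close> has period \<open>M\<close> and sums to \<open>0\<close> over a period, then grouping \<open>\<Sum> f(n)/n\<close> by residues mod \<open>M\<close>
  and adding \<open>0 = (ln N) \<Sum> f(k)\<close> turns the partial sums into combinations of the sequences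
  \<open>ln N - \<Sum>\<^sub>j 1/(j + k/M)\<close>, which tend to \<open>\<psi>(k/M)\<close>. All three functions satisfy \<open>f(-k - a) = -f(k)\<close>, which
  forces the sum over a period to vanish. For \<open>Ct\<close> this comes from \<open>sin\<^sub>p(\<pi> - w) = sin\<^sub>p(w)\<close> and
  \<open>sin\<^sub>p(w + \<pi>) = -sin\<^sub>p(w)\<close>, the latter being the quasi-periodicity of the theta product
  \<open>(x;p)\<^sub>\<infinity> (p/x;p)\<^sub>\<infinity>\<close>. The function \<open>h\<close> is \<open>Ct\<close> for the base \<open>q\<^sup>1\<^sup>/\<^sup>2\<close>, so (b) is a case of (a).
\<close>

section \<open>Periodic sequences summed against 1/n\<close>

lemma LIMSEQ_of_residue_classes:
  fixes S :: "nat \<Rightarrow> 'a :: metric_space"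
  assumes "M > 0" and lim: "\<And>r. r < M \<Longrightarrow> (\<lambda>N. S (N * M + r)) \<longlonglongrightarrow> L"
  shows "S \<longlonglongrightarrow> L"
proof (rule metric_LIMSEQ_I)
  fix e :: real assume "e > 0"
  \<comment> \<open>There are only finitely many residues below \<open>M\<close>, so one threshold
    can serve all of them.\<close>
  hence "eventually (\<lambda>N. \<forall>r\<in>{..<M}. dist (S (N * M + r)) L < e) sequentially"
    using lim by (intro eventually_ball_finite) (auto simp: tendsto_iff)
  then obtain N0 where N0: "\<And>N r. N \<ge> N0 \<Longrightarrow> r < M \<Longrightarrow> dist (S (N * M + r)) L < e"
    by (auto simp: eventually_sequentially)
  have "dist (S n) L < e" if "n \<ge> N0 * M" for n
  proof -
    have "n div M \<ge> N0"
      using that \<open>M > 0\<close> by (simp add: less_eq_div_iff_mult_less_eq)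
    with N0[of "n div M" "n mod M"] \<open>M > 0\<close> show ?thesis by simp
  qed
  thus "\<exists>no. \<forall>n\<ge>no. dist (S n) L < e" by blast
qed

lemma periodic_int_add_mult:
  fixes f :: "int \<Rightarrow> 'a" and n :: nat
  assumes "\<And>k. f (k + m) = f k"
  shows "f (k + int n * m) = f k"
proof (induction n)
  case (Suc n)
  have "f (k + int (Suc n) * m) = f ((k + int n * m) + m)"
    by (simp add: algebra_simps)
  with Suc assms show ?case by simp
qed simp

text \<open>Only partial sums of length \<open>N * M\<close> are rewritten exactly. A general
  partial sum has fewer than \<open>M\<close> further terms, each tending to 0, so convergence along
  multiples of \<open>M\<close> extends to the whole sequence.\<close>

lemma sums_periodic_over_n:
  fixes f :: "int \<Rightarrow> complex"
  assumes "M > 0" and per: "\<And>k. f (k + int M) = f k"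
    and zero: "(\<Sum>k=1..M. f (int k)) = 0"
  shows "(\<lambda>n. f (int (Suc n)) / of_nat (Suc n)) sums
           (- (1 / of_nat M) * (\<Sum>k=1..M. f (int k) * Digamma (of_nat k / of_nat M)))"
proof -
  define t where "t n = f (int (Suc n)) / of_nat (Suc n)" for n
  define L where "L = - (1 / of_nat M) * (\<Sum>k=1..M. f (int k) * Digamma (of_nat k / of_nat M))"
  have f_shift: "f (int (N * M + k)) = f (int k)" for N k
    using periodic_int_add_mult[of f "int M" "int k" N] per by (simp add: add_ac)
  have blocks: "(\<lambda>N. \<Sum>n<N * M. t n) \<longlonglongrightarrow> L"
  proof -
    have "(\<Sum>n<N * M. t n) = - (1 / of_nat M) * (\<Sum>k=1..M. f (int k) *
           (of_real (ln (real N)) - (\<Sum>n<N. inverse (of_nat k / of_nat M + of_nat n))))" for N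
    proof -
      have "(\<Sum>n<N * M. t n) = (\<Sum>j<N. \<Sum>n=j*M..<j*M+M. t n)"
        by (rule sum.nat_group[symmetric])
      also have "\<dots> = (\<Sum>j<N. \<Sum>k=1..M. f (int k) * (inverse (of_nat k / of_nat M + of_nat j) / of_nat M))"
      proof (rule sum.cong[OF refl])
        fix j
        \<comment> \<open>The terms of \<open>t\<close> are shifted by one, so position
          \<open>j * M + (k - 1)\<close> carries the denominator \<open>j * M + k\<close>. Taking
          residues in 1..M instead of 0..M-1 keeps k/M away from the pole of the digamma function at
          0.\<close>
        have "(\<Sum>n=j*M..<j*M+M. t n) = (\<Sum>k=1..M. t (j * M + (k - 1)))"
          by (rule sum.reindex_bij_witness[of _ "\<lambda>k. j * M + (k - 1)" "\<lambda>n. Suc n - j * M"]) auto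
        also have "\<dots> = (\<Sum>k=1..M. f (int k) * (inverse (of_nat k / of_nat M + of_nat j) / of_nat M))"
        proof (rule sum.cong[OF refl])
          fix k assume k: "k \<in> {1..M}"
          have "Suc (j * M + (k - 1)) = j * M + k" using k by simp
          hence "t (j * M + (k - 1)) = f (int k) / of_nat (j * M + k)"
            unfolding t_def by (simp only: f_shift)
          also have "(of_nat k / of_nat M + of_nat j) * of_nat M = (of_nat (j * M + k) :: complex)"
            using \<open>M > 0\<close> by (simp add: field_simps)
          hence "inverse (of_nat k / of_nat M + of_nat j) / of_nat M = (1 / of_nat (j * M + k) :: complex)"
            by (metis divide_divide_eq_left inverse_eq_divide)
          hence "f (int k) / of_nat (j * M + k) = f (int k) * (inverse (of_nat k / of_nat M + of_nat j) / of_nat M)"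
            by simp
          finally show "t (j * M + (k - 1)) = f (int k) * (inverse (of_nat k / of_nat M + of_nat j) / of_nat M)" .
        qed
        finally show "(\<Sum>n=j*M..<j*M+M. t n) = \<dots>" .
      qed
      also have "\<dots> = (\<Sum>k=1..M. f (int k) * (\<Sum>j<N. inverse (of_nat k / of_nat M + of_nat j)) / of_nat M)"
        by (subst sum.swap) (simp add: sum_distrib_left sum_divide_distrib)
      \<comment> \<open>Each inner sum over \<open>j\<close> grows like ln N. By \<open>zero\<close>
        the inserted product with \<open>ln (real N)\<close> is 0, and distributing it over
        \<open>k\<close> makes every summand converge separately.\<close>
      also have "\<dots> = - (1 / of_nat M) * ((\<Sum>k=1..M. f (int k)) * of_real (ln (real N)) -
                        (\<Sum>k=1..M. f (int k) * (\<Sum>j<N. inverse (of_nat k / of_nat M + of_nat j))))"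
        unfolding zero by (simp add: sum_divide_distrib)
      also have "\<dots> = - (1 / of_nat M) * (\<Sum>k=1..M. f (int k) *
           (of_real (ln (real N)) - (\<Sum>n<N. inverse (of_nat k / of_nat M + of_nat n))))"
        by (simp add: sum_distrib_right sum_subtractf right_diff_distrib)
      finally show ?thesis .
    qed
    moreover have "(\<lambda>N. - (1 / of_nat M) * (\<Sum>k=1..M. f (int k) *
           (of_real (ln (real N)) - (\<Sum>n<N. inverse (of_nat k / of_nat M + of_nat n))))) \<longlonglongrightarrow> L"
      unfolding L_def by (intro tendsto_intros Digamma_LIMSEQ) (use \<open>M > 0\<close> in auto)
    ultimately show ?thesis by simp
  qed
  have t_lim: "(\<lambda>N. t (N * M + i)) \<longlonglongrightarrow> 0" for i
  proof -
    have "(\<lambda>N. f (int (Suc i)) * (1 / of_nat (N * M + Suc i))) \<longlonglongrightarrow> f (int (Suc i)) * 0"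
    proof (intro tendsto_intros)
      have "strict_mono (\<lambda>N. N * M + Suc i)"
        using \<open>M > 0\<close> by (auto simp: strict_mono_def)
      from LIMSEQ_subseq_LIMSEQ[OF lim_1_over_n this]
      show "(\<lambda>N. 1 / of_nat (N * M + Suc i) :: complex) \<longlonglongrightarrow> 0" by (simp add: o_def)
    qed
    moreover have "t (N * M + i) = f (int (Suc i)) * (1 / of_nat (N * M + Suc i))" for N
      using f_shift[of N "Suc i"] by (simp add: t_def)
    ultimately show ?thesis by simp
  qed
  have "(\<lambda>m. \<Sum>n<m. t n) \<longlonglongrightarrow> L"
  proof (rule LIMSEQ_of_residue_classes[OF \<open>M > 0\<close>])
    fix r
    show "(\<lambda>N. \<Sum>n<N * M + r. t n) \<longlonglongrightarrow> L"
    proof (induction r)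
      case (Suc r)
      from tendsto_add[OF this t_lim[of r]] show ?case by simp
    qed (use blocks in simp)
  qed
  thus ?thesis by (simp add: sums_def L_def t_def)
qed

text \<open>The map k -> -k - a is an involution on the residues mod \<open>M\<close>, so reindexing
  along it shows that the sum over a period equals its own negative.\<close>

lemma sum_period_of_antisymmetric:
  fixes f :: "int \<Rightarrow> complex"
  assumes "M > 0" and per: "\<And>k. f (k + int M) = f k" and anti: "\<And>k. f (- k - a) = - f k"
  shows "(\<Sum>k=1..M. f (int k)) = 0"
proof -
  \<comment> \<open>\<open>periodic_int_add_mult\<close> only adds natural multiples of the period.
    Hence for k \<ge> 0 one climbs from the residue to \<open>k\<close>, and for negative
    \<open>k\<close> from \<open>k\<close> up to its residue.\<close>
  have fg: "f k = f (k mod int M)" for k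
  proof (cases "k \<ge> 0")
    case True
    with periodic_int_add_mult[of f "int M" "k mod int M" "nat (k div int M)"] per \<open>M > 0\<close>
    show ?thesis by (simp add: pos_imp_zdiv_nonneg_iff)
  next
    case False
    hence "k div int M < 0" using \<open>M > 0\<close> by (simp add: pos_imp_zdiv_neg_iff)
    with periodic_int_add_mult[of f "int M" k "nat (- (k div int M))"] per \<open>M > 0\<close>
    show ?thesis by (simp add: minus_div_mult_eq_mod)
  qed
  \<comment> \<open>The two systems of representatives 1..M and 0..M-1 differ only in that
    \<open>M\<close> is exchanged for 0.\<close>
  have *: "(\<Sum>k=1..M. f (int k)) = (\<Sum>j\<in>{0..<int M}. f j)"
    by (rule sum.reindex_bij_witness[of _ "\<lambda>j. if j = 0 then M else nat j" "\<lambda>k. int k mod int M"])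
       (use \<open>M > 0\<close> in \<open>auto simp: fg[symmetric] le_less nat_dvd_not_less\<close>)
  have "(\<Sum>j\<in>{0..<int M}. f j) = (\<Sum>j\<in>{0..<int M}. - f j)"
  proof (rule sum.reindex_bij_witness[of _ "\<lambda>j. (- j - a) mod int M" "\<lambda>j. (- j - a) mod int M"])
    fix j assume j: "j \<in> {0..<int M}"
    have "(- ((- j - a) mod int M) - a) mod int M = (- (- j - a) - a) mod int M"
      by (metis mod_diff_left_eq mod_minus_eq)
    thus "(- ((- j - a) mod int M) - a) mod int M = j" using j by simp
    thus "(- ((- j - a) mod int M) - a) mod int M = j" .
    show "- f ((- j - a) mod int M) = f j"
      using anti[of j] fg[of "- j - a"] by simp
  qed (use \<open>M > 0\<close> in auto)
  hence "(\<Sum>j\<in>{0..<int M}. f j) = 0"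
    by (simp add: sum_negf eq_neg_iff_add_eq_0)
  with * show ?thesis by simp
qed

section \<open>The infinite q-shifted factorial as an entire function of x\<close>

lemma convergent_prod_qpoch:
  fixes p x :: complex
  assumes "norm p < 1"
  shows "convergent_prod (\<lambda>i. 1 - x * p ^ i)"
proof -
  have "summable (\<lambda>i. norm ((1 - x * p ^ i) - 1))"
    using assms by (simp add: norm_mult norm_power summable_mult summable_geometric)
  thus ?thesis
    by (intro abs_convergent_prod_imp_convergent_prod summable_imp_abs_convergent_prod)
qed

text \<open>A convergent infinite product vanishes only through one of its factors.\<close>

lemma qpoch_inf_eq_0D:
  assumes "norm p < 1" "qpoch_inf x p = 0"
  shows "\<exists>i. x * p ^ i = 1"
  using prodinf_nonzero[OF convergent_prod_qpoch[OF assms(1), of x]] assms(2)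
  unfolding qpoch_inf_def by force

lemma qpoch_inf_rec:
  assumes "norm p < 1"
  shows "qpoch_inf x p = (1 - x) * qpoch_inf (x * p) p"
proof -
  have "(\<lambda>i. 1 - x * p ^ i) has_prod ((\<Prod>k<1. 1 - x * p ^ k) * (\<Prod>k. 1 - x * p ^ (k + 1)))"
    by (rule has_prod_ignore_initial_segment'[OF convergent_prod_qpoch[OF assms]])
  thus ?thesis
    unfolding qpoch_inf_def by (simp add: has_prod_iff mult_ac)
qed

text \<open>The partial products are polynomials in x. They converge uniformly on the closed unit
  disc around any \<open>x0\<close> by the Weierstrass test, with majorant
  \<open>(norm x0 + 1) * norm p ^ i\<close>.\<close>

lemma holomorphic_qpoch_inf:
  assumes "norm p < 1"
  shows "(\<lambda>x. qpoch_inf x p) holomorphic_on UNIV"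
proof (rule holomorphic_uniform_sequence[where f = "\<lambda>N x. \<Prod>i<N. 1 - x * p ^ i"])
  fix x0 :: complex
  define A where "A = cball x0 1"
  have "uniformly_convergent_on A (\<lambda>N x. \<Prod>i<N. 1 - x * p ^ i)"
  proof (rule uniformly_convergent_on_prod')
    show "uniformly_convergent_on A (\<lambda>N x. \<Sum>i<N. norm (1 - x * p ^ i - 1))"
    proof (rule Weierstrass_m_test')
      fix i x assume "x \<in> A"
      hence "norm x \<le> norm x0 + 1"
        using norm_triangle_ineq2[of x x0] by (simp add: A_def dist_norm norm_minus_commute)
      thus "norm (norm (1 - x * p ^ i - 1)) \<le> (norm x0 + 1) * norm p ^ i"
        by (simp add: norm_mult norm_power mult_right_mono)
    qed (use assms in \<open>simp add: summable_mult summable_geometric\<close>)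
  qed (auto simp: A_def intro!: continuous_intros)
  then obtain g where g: "uniform_limit A (\<lambda>N x. \<Prod>i<N. 1 - x * p ^ i) g sequentially"
    by (auto simp: uniformly_convergent_on_def)
  have "g x = qpoch_inf x p" if "x \<in> A" for x
  proof (rule LIMSEQ_unique)
    show "(\<lambda>N. \<Prod>i<N. 1 - x * p ^ i) \<longlonglongrightarrow> g x"
      using tendsto_uniform_limitI[OF g that] .
    show "(\<lambda>N. \<Prod>i<N. 1 - x * p ^ i) \<longlonglongrightarrow> qpoch_inf x p"
      using convergent_prod_LIMSEQ[OF convergent_prod_qpoch[OF assms, of x]]
      by (simp add: qpoch_inf_def LIMSEQ_lessThan_iff_atMost)
  qed
  with g have "uniform_limit A (\<lambda>N x. \<Prod>i<N. 1 - x * p ^ i) (\<lambda>x. qpoch_inf x p) sequentially"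
    using uniform_limit_cong'[of A "\<lambda>N x. \<Prod>i<N. 1 - x * p ^ i" "\<lambda>N x. \<Prod>i<N. 1 - x * p ^ i" g "\<lambda>x. qpoch_inf x p"]
    by simp
  thus "\<exists>d>0. cball x0 d \<subseteq> UNIV \<and>
          uniform_limit (cball x0 d) (\<lambda>N x. \<Prod>i<N. 1 - x * p ^ i) (\<lambda>x. qpoch_inf x p) sequentially"
    unfolding A_def by (intro exI[of _ 1]) simp
qed (simp, intro holomorphic_intros)

lemma field_differentiable_qpoch_inf:
  assumes "norm p < 1" "g field_differentiable at z"
  shows "(\<lambda>z. qpoch_inf (g z) p) field_differentiable at z"
proof -
  have "(\<lambda>x. qpoch_inf x p) field_differentiable at (g z)"
    using holomorphic_qpoch_inf[OF assms(1)] by (simp add: holomorphic_on_def)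
  from field_differentiable_compose[OF assms(2) this] show ?thesis
    by (simp add: o_def)
qed

section \<open>Powers of the base, and the q-gamma function at real non-integers\<close>

lemma norm_base_pow_lt_1:
  assumes "Im \<sigma> > 0"
  shows "norm (base_pow \<sigma> 1) < 1"
  using assms by (simp add: base_pow_def base_log_def)

lemma base_pow_add: "base_pow \<sigma> (s + t) = base_pow \<sigma> s * base_pow \<sigma> t"
  by (simp add: base_pow_def distrib_left exp_add)

lemma base_pow_minus: "base_pow \<sigma> (- s) = inverse (base_pow \<sigma> s)"
  by (simp add: base_pow_def exp_minus)

lemma base_pow_double: "base_pow (2 * \<sigma>) s = base_pow \<sigma> (2 * s)"
  by (simp add: base_pow_def base_log_def mult_ac)

lemma base_pow_nonzero [simp]: "base_pow \<sigma> s \<noteq> 0"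
  by (simp add: base_pow_def)

lemma has_field_derivative_base_pow:
  assumes "(g has_field_derivative g') (at z within A)"
  shows "((\<lambda>z. base_pow \<sigma> (g z)) has_field_derivative base_pow \<sigma> (g z) * (base_log \<sigma> * g')) (at z within A)"
  unfolding base_pow_def by (intro DERIV_chain2[OF DERIV_exp] DERIV_cmult assms)

lemma field_differentiable_base_pow:
  assumes "g field_differentiable at z"
  shows "(\<lambda>z. base_pow \<sigma> (g z)) field_differentiable at z"
  using assms has_field_derivative_base_pow unfolding field_differentiable_def by blast

text \<open>A vanishing factor would mean that a power of the base with real exponent x + i equals
  1. Taking norms removes the periodicity of exp and leaves x + i = 0. For complex exponents that
  periodicity produces further zeros off the real line, whence the restriction to real
  \<open>x\<close>.\<close>

lemma qpoch_inf_base_pow_nonzero: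
  fixes x :: real
  assumes "Im \<sigma> > 0" "x \<notin> \<int>"
  shows "qpoch_inf (base_pow \<sigma> (of_real x)) (base_pow \<sigma> 1) \<noteq> 0"
proof
  assume "qpoch_inf (base_pow \<sigma> (of_real x)) (base_pow \<sigma> 1) = 0"
  then obtain i where "base_pow \<sigma> (of_real x) * base_pow \<sigma> 1 ^ i = 1"
    using qpoch_inf_eq_0D[OF norm_base_pow_lt_1[OF assms(1)]] by blast
  also have "base_pow \<sigma> (of_real x) * base_pow \<sigma> 1 ^ i = base_pow \<sigma> (of_real (x + real i))"
    by (simp add: base_pow_def exp_add distrib_left exp_of_nat_mult[symmetric] mult_ac)
  finally have "norm (base_pow \<sigma> (of_real (x + real i))) = 1" by simp
  hence "pi * Im \<sigma> * (x + real i) = 0"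
    by (simp add: base_pow_def base_log_def)
  hence "x = - real i"
    using assms(1) by (simp add: add_eq_0_iff2)
  with assms(2) show False by simp
qed

lemma qpoch_inf_self_nonzero:
  assumes "norm p < 1"
  shows "qpoch_inf p p \<noteq> 0"
proof
  assume "qpoch_inf p p = 0"
  then obtain i where "p * p ^ i = 1"
    using qpoch_inf_eq_0D[OF assms] by blast
  hence "norm p ^ Suc i = 1" by (metis norm_one norm_power power_Suc)
  moreover have "norm p ^ Suc i < 1"
    using assms by (intro power_less_one_iff[THEN iffD2]) auto
  ultimately show False by simp
qed

lemma qGamma_nonzero:
  fixes x :: real
  assumes "Im \<sigma> > 0" "x \<notin> \<int>"
  shows "qGamma \<sigma> (of_real x) \<noteq> 0"
  using qpoch_inf_base_pow_nonzero[OF assms] norm_base_pow_lt_1[OF assms(1)]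
    qpoch_inf_self_nonzero[of "base_pow \<sigma> 1"]
  by (auto simp: qGamma_def Let_def)

lemma qGamma_field_differentiable:
  fixes x :: real
  assumes "Im \<sigma> > 0" "x \<notin> \<int>"
  shows "qGamma \<sigma> field_differentiable at (of_real x)"
proof -
  have p: "1 - base_pow \<sigma> 1 \<noteq> 0"
    using norm_base_pow_lt_1[OF assms(1)] by auto
  have "(\<lambda>z. (1 - base_pow \<sigma> 1) powr (1 - z)) holomorphic_on UNIV"
    using p by (auto simp: powr_def intro!: holomorphic_intros)
  hence "(\<lambda>z. (1 - base_pow \<sigma> 1) powr (1 - z)) field_differentiable at (of_real x)"
    by (simp add: holomorphic_on_def)
  thus ?thesis
    using qpoch_inf_base_pow_nonzero[OF assms] norm_base_pow_lt_1[OF assms(1)]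
    unfolding qGamma_def Let_def
    by (intro field_differentiable_qpoch_inf field_differentiable_base_pow field_differentiable_mult field_differentiable_divide
          field_differentiable_const field_differentiable_ident) auto
qed

section \<open>Gosper's q-sine as a theta product, and its logarithmic derivative\<close>

lemma qSin_product:
  assumes "Im \<sigma> > 0"
  obtains K where "\<And>w. qSin \<sigma> w = K * (base_pow \<sigma> (w / of_real pi * (w / of_real pi - 1)) *
     (qpoch_inf (base_pow (2 * \<sigma>) (w / of_real pi)) (base_pow (2 * \<sigma>) 1) *
      qpoch_inf (base_pow (2 * \<sigma>) (1 - w / of_real pi)) (base_pow (2 * \<sigma>) 1)))"
proof
  define p where "p = base_pow (2 * \<sigma>) 1"
  define K where "K = base_pow \<sigma> (1/4) * (qGamma (2 * \<sigma>) (1/2))\<^sup>2 / ((qpoch_inf p p)\<^sup>2 * (1 - p))"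
  have p: "norm p < 1" "p \<noteq> 1"
    using norm_base_pow_lt_1[of "2 * \<sigma>"] assms by (auto simp: p_def)
  fix w
  define z where "z = w / complex_of_real pi"
  \<comment> \<open>The exponents 1 - z and z add up to 1, so nothing depending on \<open>z\<close>
    remains and \<open>K\<close> is a genuine constant.\<close>
  have "(1 - p) powr (1 - z) * (1 - p) powr (1 - (1 - z)) = 1 - p"
    using p by (simp flip: powr_add)
  \<comment> \<open>This includes the poles of q-gamma: there a factorial on the right is 0 and
    division by 0 gives 0 on both sides. The product formula for \<open>qSin\<close> therefore holds
    for every \<open>w\<close>.\<close>
  hence "qGamma (2 * \<sigma>) z * qGamma (2 * \<sigma>) (1 - z) = (qpoch_inf p p)\<^sup>2 * (1 - p) /
      (qpoch_inf (base_pow (2 * \<sigma>) z) p * qpoch_inf (base_pow (2 * \<sigma>) (1 - z)) p)"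
    unfolding qGamma_def Let_def p_def[symmetric] by (simp add: power2_eq_square)
  thus "qSin \<sigma> w = K * (base_pow \<sigma> (w / of_real pi * (w / of_real pi - 1)) *
     (qpoch_inf (base_pow (2 * \<sigma>) (w / of_real pi)) (base_pow (2 * \<sigma>) 1) *
      qpoch_inf (base_pow (2 * \<sigma>) (1 - w / of_real pi)) (base_pow (2 * \<sigma>) 1)))"
    unfolding qSin_def Let_def z_def[symmetric] p_def[symmetric] K_def by simp
qed

lemma qSin_reflect: "qSin \<sigma> (of_real pi - w) = qSin \<sigma> w"
proof -
  have "(of_real pi - w) / of_real pi = 1 - w / of_real pi"
    by (simp add: diff_divide_distrib)
  moreover have "(1 - z) * (1 - z - 1) = z * (z - 1)" "1 - (1 - z) = z" for z :: complex
    by (simp_all add: algebra_simps)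
  ultimately show ?thesis
    unfolding qSin_def Let_def by (simp only: mult.commute)
qed

lemma qSin_shift:
  assumes "Im \<sigma> > 0"
  shows "qSin \<sigma> (w + of_real pi) = - qSin \<sigma> w"
proof -
  define p where "p = base_pow (2 * \<sigma>) 1"
  define z where "z = w / complex_of_real pi"
  define x where "x = base_pow (2 * \<sigma>) z"
  have p: "norm p < 1"
    using norm_base_pow_lt_1[of "2 * \<sigma>"] assms by (auto simp: p_def)
  obtain K where K: "\<And>w. qSin \<sigma> w = K * (base_pow \<sigma> (w / of_real pi * (w / of_real pi - 1)) *
     (qpoch_inf (base_pow (2 * \<sigma>) (w / of_real pi)) p *
      qpoch_inf (base_pow (2 * \<sigma>) (1 - w / of_real pi)) p))"
    using qSin_product[OF assms] unfolding p_def by blast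
  have z1: "(w + of_real pi) / of_real pi = z + 1"
    by (simp add: z_def add_divide_distrib)
  have [simp]: "x \<noteq> 0" by (simp add: x_def)
  \<comment> \<open>Since (z + 1) z = z (z - 1) + 2 z, the quadratic exponent contributes the factor
    \<open>x\<close>, which the theta product compensates.\<close>
  have e: "base_pow \<sigma> ((z + 1) * (z + 1 - 1)) = base_pow \<sigma> (z * (z - 1)) * x"
    unfolding x_def base_pow_double base_pow_add[symmetric] by (simp add: algebra_simps)
  have x1: "base_pow (2 * \<sigma>) (z + 1) = x * p" "base_pow (2 * \<sigma>) (1 - (z + 1)) = inverse x"
    "base_pow (2 * \<sigma>) (1 - z) = inverse x * p"
    using base_pow_add[of "2 * \<sigma>" "- z" 1] by (simp_all add: x_def p_def base_pow_add base_pow_minus)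
  \<comment> \<open>Splitting off the first factors of the products at \<open>x\<close> and
    \<open>inverse x\<close> reduces the claim to x (1 - 1/x) = -(1 - x).\<close>
  have \<theta>: "x * (qpoch_inf (x * p) p * qpoch_inf (inverse x) p) =
          - (qpoch_inf x p * qpoch_inf (inverse x * p) p)"
    unfolding qpoch_inf_rec[OF p, of x] qpoch_inf_rec[OF p, of "inverse x"]
    by (simp add: field_simps)
  have "qSin \<sigma> (w + of_real pi) = K * (base_pow \<sigma> (z * (z - 1)) *
          (x * (qpoch_inf (x * p) p * qpoch_inf (inverse x) p)))"
    unfolding K z1 e x1 by (simp only: mult.assoc)
  also have "\<dots> = - qSin \<sigma> w"
    unfolding \<theta> K z_def[symmetric] x1 x_def[symmetric] by simp
  finally show ?thesis .
qed

text \<open>The value at pi - w is computed twice, once by reflection and once as a shift of -w by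
  pi.\<close>

lemma qSin_minus:
  assumes "Im \<sigma> > 0"
  shows "qSin \<sigma> (- w) = - qSin \<sigma> w"
  using qSin_shift[OF assms, of "- w"] qSin_reflect[of \<sigma> w] by (simp add: add.commute)

text \<open>The product form gives differentiability at every point, whereas the q-gamma factors of
  the definition have poles.\<close>

lemma qSin_field_differentiable:
  assumes "Im \<sigma> > 0"
  shows "qSin \<sigma> field_differentiable at w"
proof -
  have p: "norm (base_pow (2 * \<sigma>) 1) < 1"
    using norm_base_pow_lt_1[of "2 * \<sigma>"] assms by auto
  obtain K where K: "qSin \<sigma> =
    (\<lambda>w. K * (base_pow \<sigma> (w / of_real pi * (w / of_real pi - 1)) *
     (qpoch_inf (base_pow (2 * \<sigma>) (w / of_real pi)) (base_pow (2 * \<sigma>) 1) *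
      qpoch_inf (base_pow (2 * \<sigma>) (1 - w / of_real pi)) (base_pow (2 * \<sigma>) 1))))"
    by (rule qSin_product[OF assms]) (metis (no_types, lifting) ext)
  have l: "(\<lambda>w. w / of_real pi) field_differentiable at w"
    by (intro field_differentiable_divide field_differentiable_const field_differentiable_ident) simp
  show ?thesis
    unfolding K
    by (intro field_differentiable_mult field_differentiable_qpoch_inf field_differentiable_base_pow
          field_differentiable_diff field_differentiable_const l p)
qed

text \<open>Shifting by pi negates both \<open>qSin\<close> and its derivative, so the signs cancel
  in the quotient.\<close>

lemma qCt_shift:
  assumes "Im \<sigma> > 0"
  shows "qCt \<sigma> (w + of_real pi) = qCt \<sigma> w"
proof -
  have "(qSin \<sigma> has_field_derivative deriv (qSin \<sigma>) (w + of_real pi)) (at (w + of_real pi))"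
    using qSin_field_differentiable[OF assms] by (simp add: field_differentiable_derivI)
  hence "((\<lambda>w. - qSin \<sigma> w) has_field_derivative deriv (qSin \<sigma>) (w + of_real pi)) (at w)"
    unfolding DERIV_shift by (simp add: qSin_shift[OF assms])
  from DERIV_minus[OF this] have "deriv (qSin \<sigma>) w = - deriv (qSin \<sigma>) (w + of_real pi)"
    by (simp add: DERIV_imp_deriv)
  thus ?thesis
    by (simp add: qCt_def qSin_shift[OF assms])
qed

text \<open>\<open>qSin\<close> is odd, hence its derivative is even and the quotient is
  odd.\<close>

lemma qCt_minus:
  assumes "Im \<sigma> > 0"
  shows "qCt \<sigma> (- w) = - qCt \<sigma> w"
proof -
  have "(qSin \<sigma> has_field_derivative deriv (qSin \<sigma>) (- w)) (at (- w))"
    using qSin_field_differentiable[OF assms] by (simp add: field_differentiable_derivI)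
  from DERIV_minus[OF DERIV_chain2[OF this DERIV_minus[OF DERIV_ident]]]
  have "deriv (qSin \<sigma>) w = deriv (qSin \<sigma>) (- w)"
    by (simp add: DERIV_imp_deriv qSin_minus[OF assms])
  thus ?thesis
    by (simp add: qCt_def qSin_minus[OF assms])
qed

text \<open>This is the logarithmic derivative of the defining formula: the exponent z (z - 1) gives
  2 z - 1, the argument 1 - z reverses one sign, and w = pi z gives the factor 1/pi. Non-integrality
  of \<open>x\<close> keeps both q-gamma values finite and nonzero.\<close>

lemma qCt_eq_qDigamma:
  fixes x :: real
  assumes "Im \<sigma> > 0" "x \<notin> \<int>"
  shows "qCt \<sigma> (of_real (pi * x)) = 1 / of_real pi * (base_log \<sigma> * (2 * of_real x - 1)
           - qDigamma (2 * \<sigma>) (of_real x) + qDigamma (2 * \<sigma>) (1 - of_real x))"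
proof -
  define G where "G = qGamma (2 * \<sigma>)"
  define z where "z = complex_of_real x"
  define C where "C = base_pow \<sigma> (1/4) * (G (1/2))\<^sup>2"
  have x': "1 - x \<notin> \<int>"
  proof
    assume "1 - x \<in> \<int>"
    hence "1 - (1 - x) \<in> \<int>" by (intro Ints_diff) auto
    with assms(2) show False by simp
  qed
  \<comment> \<open>This makes the q-gamma value at 1/2 nonzero, so that the constant
    \<open>C\<close> can be cancelled.\<close>
  have half: "(1 / 2 :: real) \<notin> \<int>"
    using fraction_not_in_Ints[of 2 1, where ?'a = real] by simp
  have Im2: "Im (2 * \<sigma>) > 0" using assms(1) by simp
  have z1: "1 - z = of_real (1 - x)" by (simp add: z_def)
  have nz: "G z \<noteq> 0" "G (1 - z) \<noteq> 0" "C \<noteq> 0"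
    using qGamma_nonzero[OF Im2 assms(2)] qGamma_nonzero[OF Im2 x'] qGamma_nonzero[OF Im2 half]
    unfolding G_def z1 by (simp_all add: z_def C_def G_def)
  have d: "(G has_field_derivative deriv G z) (at z)"
      "(G has_field_derivative deriv G (1 - z)) (at (1 - z))"
    using qGamma_field_differentiable[OF Im2 assms(2)] qGamma_field_differentiable[OF Im2 x']
    unfolding G_def z1 by (simp_all add: z_def field_differentiable_derivI)
  define w where "w = complex_of_real (pi * x)"
  have wz: "w / of_real pi = z" by (simp add: w_def z_def)
  define E where "E = base_pow \<sigma> (z * (z - 1))"
  have E: "E \<noteq> 0" by (simp add: E_def)
  have d1: "((\<lambda>w. G (w / of_real pi)) has_field_derivative deriv G z * (1 / of_real pi)) (at w)"
    by (rule DERIV_chain2[where f = G]) (use d(1) in \<open>auto simp: wz intro!: derivative_eq_intros\<close>)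
  have d2: "((\<lambda>w. G (1 - w / of_real pi)) has_field_derivative deriv G (1 - z) * (- 1 / of_real pi)) (at w)"
    by (rule DERIV_chain2[where f = G]) (use d(2) in \<open>auto simp: wz intro!: derivative_eq_intros\<close>)
  have d3: "((\<lambda>w. base_pow \<sigma> (w / of_real pi * (w / of_real pi - 1))) has_field_derivative
              E * (base_log \<sigma> * ((2 * z - 1) / of_real pi))) (at w)"
  proof -
    have "((\<lambda>w. w / of_real pi * (w / of_real pi - 1)) has_field_derivative (2 * z - 1) / of_real pi) (at w)"
      by (auto intro!: derivative_eq_intros simp: wz[symmetric] field_simps)
    from has_field_derivative_base_pow[OF this] show ?thesis
      by (simp only: wz E_def)
  qed
  have qs: "qSin \<sigma> = (\<lambda>w. C * (base_pow \<sigma> (w / of_real pi * (w / of_real pi - 1)) /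
      (G (w / of_real pi) * G (1 - w / of_real pi))))"
    by (simp add: qSin_def Let_def C_def G_def fun_eq_iff)
  have "(qSin \<sigma> has_field_derivative
      C * ((E * (base_log \<sigma> * ((2 * z - 1) / of_real pi)) * (G z * G (1 - z)) -
       E * (deriv G z * (1 / of_real pi) * G (1 - z) + deriv G (1 - z) * (- 1 / of_real pi) * G z)) /
         ((G z * G (1 - z)) * (G z * G (1 - z))))) (at w)"
    unfolding qs using DERIV_cmult[OF DERIV_divide[OF d3 DERIV_mult[OF d1 d2]], of C] nz
    by (simp add: wz E_def)
  hence "deriv (qSin \<sigma>) w = C * ((E * (base_log \<sigma> * ((2 * z - 1) / of_real pi)) * (G z * G (1 - z)) -
       E * (deriv G z * (1 / of_real pi) * G (1 - z) + deriv G (1 - z) * (- 1 / of_real pi) * G z)) /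
         ((G z * G (1 - z)) * (G z * G (1 - z))))"
    by (rule DERIV_imp_deriv)
  moreover have "qSin \<sigma> w = C * (E / (G z * G (1 - z)))"
    by (simp only: qs wz E_def)
  ultimately have "qCt \<sigma> w = 1 / of_real pi * (base_log \<sigma> * (2 * z - 1)
           - deriv G z / G z + deriv G (1 - z) / G (1 - z))"
    unfolding qCt_def using nz E by (simp only:) (simp add: field_simps)
  thus ?thesis
    by (simp add: w_def z_def G_def qDigamma_def)
qed

section \<open>Periodicity and antisymmetry of the three functions, and the final sums\<close>

lemma h_fun_eq_qCt:
  assumes "Im \<tau> > 0" "M > 0" "odd a"
  shows "h_fun \<tau> M a k = qCt (\<tau> / 2) (of_int (2 * k + a) * of_real pi / of_nat (2 * M))"
proof -
  \<comment> \<open>With \<open>a\<close> odd this is an odd number over an even one, hence not an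
    integer, as the digamma formula requires.\<close>
  define x where "x = real_of_int (2 * k + a) / real (2 * M)"
  have "x \<notin> \<int>"
  proof
    assume "x \<in> \<int>"
    then obtain m where "x = of_int m" by (auto elim: Ints_cases)
    hence "real_of_int (2 * k + a) = of_int (m * int (2 * M))"
      using \<open>M > 0\<close> by (simp add: x_def field_simps)
    hence "2 * k + a = m * int (2 * M)" by (simp only: of_int_eq_iff)
    hence "even (2 * k + a)" by simp
    with \<open>odd a\<close> show False by simp
  qed
  have cx: "of_int (2 * k + a) / of_nat (2 * M) = complex_of_real x"
    by (simp add: x_def)
  have lhs: "of_int (2 * k + a - int M) / of_nat (2 * M) = complex_of_real x - 1 / 2"
    unfolding cx[symmetric] using \<open>M > 0\<close> by (simp add: field_simps)
  have arg: "of_int (2 * k + a) * of_real pi / of_nat (2 * M) = complex_of_real (pi * x)"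
    by (simp add: x_def)
  \<comment> \<open>The q-sine uses q-gamma in the squared base; halving \<open>\<tau>\<close>
    cancels this doubling and leaves q-digamma in the base q itself.\<close>
  have "qCt (\<tau> / 2) (of_real (pi * x)) = 1 / of_real pi * (base_log (\<tau> / 2) * (2 * of_real x - 1)
           - qDigamma (2 * (\<tau> / 2)) (of_real x) + qDigamma (2 * (\<tau> / 2)) (1 - of_real x))"
    using assms \<open>x \<notin> \<int>\<close> by (intro qCt_eq_qDigamma) auto
  also have "base_log (\<tau> / 2) * (2 * of_real x - 1) = base_log \<tau> * (of_real x - 1 / 2)"
    by (simp add: base_log_def field_simps)
  finally show ?thesis
    unfolding h_fun_def lhs cx arg by simp
qed

lemma f_fun_shift:
  assumes "M > 0"
  shows "f_fun \<tau> M a (k + int M) = f_fun \<tau> M a k"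
proof -
  have "f_term \<tau> M a (k + int M) n = f_term \<tau> M a k n" for n
  proof -
    have "of_int (2 * (k + int M) + a) * of_nat n * pi / of_nat M =
            of_int (2 * k + a) * of_nat n * pi / of_nat M + of_int (int n) * (2 * pi)"
      using assms by (simp add: field_simps)
    hence "sin (of_int (2 * (k + int M) + a) * of_nat n * pi / of_nat M) =
             sin (of_int (2 * k + a) * of_nat n * pi / of_nat M)"
      using sin_int_2pin[of "int n"] cos_int_2pin[of "int n"] by (simp add: sin_add mult.commute)
    thus ?thesis unfolding f_term_def by simp
  qed
  thus ?thesis by (simp add: f_fun_def)
qed

text \<open>As 2 (-k - a) + a = -(2 k + a), every sine changes sign. Summability is what allows the
  sign to be taken out of the infinite sum.\<close>

lemma f_fun_reflect:
  assumes "Im \<tau> > 0" "M > 0"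
  shows "f_fun \<tau> M a (- k - a) = - f_fun \<tau> M a k"
proof -
  have "f_term \<tau> M a (- k - a) n = - f_term \<tau> M a k n" for n
  proof -
    have "of_int (2 * (- k - a) + a) * of_nat n * pi / of_nat M =
            - (of_int (2 * k + a) * of_nat n * pi / of_nat M)"
      using assms by (simp add: field_simps)
    hence "sin (of_int (2 * (- k - a) + a) * of_nat n * pi / of_nat M) =
             - sin (of_int (2 * k + a) * of_nat n * pi / of_nat M)"
      by (simp only: sin_minus)
    thus ?thesis unfolding f_term_def by simp
  qed
  thus ?thesis
    using suminf_minus[OF summable_f_term[OF assms]] by (simp add: f_fun_def)
qed

lemma sums_antisymmetric_periodic_over_n:
  fixes f :: "int \<Rightarrow> complex"
  assumes "M > 0" and "\<And>k. f (k + int M) = f k" and "\<And>k. f (- k - a) = - f k"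
  shows "(\<lambda>n. f (int (Suc n)) / of_nat (Suc n)) sums
           (- (1 / of_nat M) * (\<Sum>k=1..M. f (int k) * Digamma (of_nat k / of_nat M)))"
  using assms by (intro sums_periodic_over_n sum_period_of_antisymmetric[of M f a]) auto

text \<open>Adding \<open>M\<close> to \<open>k\<close> moves the argument by exactly pi, a period
  of \<open>qCt\<close>.\<close>

lemma qCt_lattice_shift:
  assumes "Im \<sigma> > 0" "M > 0"
  shows "qCt \<sigma> (of_int (2 * (k + int M) + a) * of_real pi / of_nat (2 * M)) =
         qCt \<sigma> (of_int (2 * k + a) * of_real pi / of_nat (2 * M))"
proof -
  have "of_int (2 * (k + int M) + a) * of_real pi / of_nat (2 * M) =
          of_int (2 * k + a) * of_real pi / of_nat (2 * M) + complex_of_real pi"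
    using assms(2) by (simp add: field_simps)
  thus ?thesis by (simp only: qCt_shift[OF assms(1)])
qed

lemma qCt_lattice_reflect:
  assumes "Im \<sigma> > 0"
  shows "qCt \<sigma> (of_int (2 * (- k - a) + a) * of_real pi / of_nat (2 * M)) =
         - qCt \<sigma> (of_int (2 * k + a) * of_real pi / of_nat (2 * M))"
proof -
  have "of_int (2 * (- k - a) + a) * of_real pi / of_nat (2 * M) =
          - (of_int (2 * k + a) * complex_of_real pi / of_nat (2 * M))"
    unfolding minus_divide_left by (rule arg_cong2[of _ _ _ _ "(/)"]) (simp_all add: algebra_simps)
  thus ?thesis by (simp only: qCt_minus[OF assms])
qed

theorem theorem1p1:
  fixes \<tau> :: complex and M :: nat and a :: int
  assumes "Im \<tau> > 0" and "M > 1" and "odd a"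
  shows
    "((\<lambda>n. 1 / of_nat (Suc n) *
          qCt \<tau> (of_int (2 * int (Suc n) + a) * of_real pi / of_nat (2 * M)))
        sums (- (1 / of_nat M) *
          (\<Sum>k=1..M. qCt \<tau> (of_int (2 * int k + a) * of_real pi / of_nat (2 * M)) *
             Digamma (of_nat k / of_nat M))))
     \<and> (\<forall>k. h_fun \<tau> M a (k + int M) = h_fun \<tau> M a k)
     \<and> ((\<lambda>n. h_fun \<tau> M a (int (Suc n)) / of_nat (Suc n))
        sums (- (1 / of_nat M) *
          (\<Sum>k=1..M. h_fun \<tau> M a (int k) * Digamma (of_nat k / of_nat M))))
     \<and> (\<forall>k. f_fun \<tau> M a (k + int M) = f_fun \<tau> M a k)
     \<and> ((\<lambda>n. f_fun \<tau> M a (int (Suc n)) / of_nat (Suc n))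
        sums (- (1 / of_nat M) *
          (\<Sum>k=1..M. f_fun \<tau> M a (int k) * Digamma (of_nat k / of_nat M))))"
proof -
  have M: "M > 0" using assms(2) by simp
  have Im2: "Im (\<tau> / 2) > 0" using assms(1) by simp
  note h = h_fun_eq_qCt[OF assms(1) M assms(3)]
  have h_shift: "h_fun \<tau> M a (k + int M) = h_fun \<tau> M a k" for k
    unfolding h by (rule qCt_lattice_shift[OF Im2 M])
  have h_reflect: "h_fun \<tau> M a (- k - a) = - h_fun \<tau> M a k" for k
    unfolding h by (rule qCt_lattice_reflect[OF Im2])
  define c where "c k = qCt \<tau> (of_int (2 * k + a) * of_real pi / of_nat (2 * M))" for k
  have "(\<lambda>n. c (int (Suc n)) / of_nat (Suc n)) sums
           (- (1 / of_nat M) * (\<Sum>k=1..M. c (int k) * Digamma (of_nat k / of_nat M)))"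
    by (rule sums_antisymmetric_periodic_over_n[OF M, where a = a])
       (simp_all only: c_def qCt_lattice_shift[OF assms(1) M] qCt_lattice_reflect[OF assms(1)])
  moreover have "c k / n = 1 / n * c k" for k and n :: complex
    by simp
  ultimately have "(\<lambda>n. 1 / of_nat (Suc n) * c (int (Suc n))) sums
           (- (1 / of_nat M) * (\<Sum>k=1..M. c (int k) * Digamma (of_nat k / of_nat M)))"
    by (simp only:)
  thus ?thesis
    unfolding c_def
    using sums_antisymmetric_periodic_over_n[OF M h_shift h_reflect] h_shift
      sums_antisymmetric_periodic_over_n[OF M f_fun_shift[OF M] f_fun_reflect[OF assms(1) M]]
      f_fun_shift[OF M] by blast
qed

end
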